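(* Let $G$ be a non-complete chordal graph of order $n$ with clique number $d$, let $K_d=\{x_1,\ldots,x_d\}$ be a maximum clique, let $\sigma$ be an admissible PEO for $(G,K_d)$, and let $T=\alpha_\sigma(G)$. Then: (a) $d_i(T)\le d_i(G)$ for every $i=1,\ldots,d$; (b) $d_i(T)=d_i(G)$ for every $i>\widetilde{\kappa}(G)$.
   Context: Graphs are finite and simple; chordal means every cycle of length at least $4$ has a chord. A PEO (perfect elimination ordering) is a bijection $\sigma:\{1,\ldots,n\}\to V(G)$ such that each $\sigma(i)$ is simplicial (its neighbourhood is a clique) in the subgraph induced by $\{\sigma(i),\ldots,\sigma(n)\}$. $N_\sigma(v)=\{u\in N(v):\sigma^{-1}(v)<\sigma^{-1}(u)\}$, $n_\sigma(v)=|N_\sigma(v)|$, and for a maximal clique $C$, $s(C)=\{x\in C:N_\sigma(x)\not\subseteq C\}$. A PEO $\sigma$ is admissible for $(G,K_d)$ if: (a) every vertex outside $K_d$ precedes every vertex of $K_d$ and $\sigma^{-1}(x_i)=n-i+1$ for $i=1,\ldots,d$; and for every maximal clique $C$: (b) $\sigma^{-1}(u)<\sigma^{-1}(v)$ for all $u\in C\setminus s(C)$, $v\in s(C)$; (c) if $|s(C)|<i\le|C|$ there is a unique $u\in C\setminus s(C)$ with $n_\sigma(u)=i-1$; (d) for every other maximal clique $C'$ with $C\cap C'\ne\emptyset$, either all of $C\setminus C'$ or all of $C'\setminus C$ precede all of $C\cap C'$ in $\sigma$. The graph $\alpha_\sigma(G)$ has vertex set $V(G)$ and edge set $\alpha_\sigma(E(G))$,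 where $\alpha_\sigma(uv)=uv$ for edges inside $K_d$, and for $u\notin K_d$ with $N_\sigma(u)=\{u_1,\ldots,u_{n_\sigma(u)}\}$ listed so that $\sigma^{-1}(u_1)<\cdots<\sigma^{-1}(u_{n_\sigma(u)})$, $\alpha_\sigma(uu_i)=ux_i$. A clique $C$ dominates a clique $C'$ if $C\subseteq C'$; a dominating $i$--clique of a graph $H$ is a set of $i$--cliques of $H$ such that every maximal clique of order at least $i$ is dominated by one of them; $d_i(H)$ is the minimum size of a dominating $i$--clique. $\widetilde{\kappa}(G)=\max\{|C\cap C'|: C,C'\text{ maximal cliques of }G\}$ (over pairs of distinct maximal cliques). *)

theory Defs
  imports "Graph_Theory.Graph_Theory"
begin

text \<open>
  A finite simple graph is a \<^locale>\<open>pair_graph\<close>: a finite symmetric loop-free digraph, whose arcs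
  \<open>(u, v)\<close> and \<open>(v, u)\<close> together stand for the edge \<open>uv\<close>. In the library \<open>u \<rightarrow>\<^bsub>G\<^esub> v\<close> means
  adjacency; it is unrelated to domination of cliques.
\<close>

section \<open>Cliques\<close>

definition is_clique :: "('a, 'b) pre_digraph \<Rightarrow> 'a set \<Rightarrow> bool" where
  "is_clique G C \<longleftrightarrow> C \<subseteq> verts G \<and> (\<forall>u\<in>C. \<forall>v\<in>C. u \<noteq> v \<longrightarrow> u \<rightarrow>\<^bsub>G\<^esub> v)"

definition is_maximal_clique :: "('a, 'b) pre_digraph \<Rightarrow> 'a set \<Rightarrow> bool" where
  "is_maximal_clique G C \<longleftrightarrow> is_clique G C \<and> (\<forall>C'. is_clique G C' \<and> C \<subseteq> C' \<longrightarrow> C' = C)"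

definition clique_number :: "('a, 'b) pre_digraph \<Rightarrow> nat" where
  "clique_number G = Max {card C | C. is_clique G C}"

definition kappa_tilde :: "('a, 'b) pre_digraph \<Rightarrow> nat" where
  "kappa_tilde G = Max {card (C \<inter> C') | C C'.
     is_maximal_clique G C \<and> is_maximal_clique G C' \<and> C \<noteq> C'}"

text \<open>
  A family \<open>D\<close> of \<open>i\<close>-cliques is dominating if every maximal clique of order at least \<open>i\<close>
  contains a member of \<open>D\<close>. If there is no such maximal clique, the empty family is dominating,
  so the number \<open>d\<^sub>i\<close> is 0 for \<open>i\<close> larger than the clique number.
\<close>

definition dominating_cliques :: "('a, 'b) pre_digraph \<Rightarrow> nat \<Rightarrow> 'a set set \<Rightarrow> bool" where
  "dominating_cliques H i D \<longleftrightarrow>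
     (\<forall>C\<in>D. is_clique H C \<and> card C = i) \<and>
     (\<forall>C'. is_maximal_clique H C' \<and> i \<le> card C' \<longrightarrow> (\<exists>C\<in>D. C \<subseteq> C'))"

definition dom_clique_number :: "('a, 'b) pre_digraph \<Rightarrow> nat \<Rightarrow> nat" where
  "dom_clique_number H i = (LEAST k. \<exists>D. dominating_cliques H i D \<and> card D = k)"


section \<open>Chordal graphs and perfect elimination orderings\<close>

text \<open>
  The library's cycles are arc lists without repeated vertices, so among those of length at
  least 4 there are no degenerate ones. A chord joins two vertices of the cycle but is, in
  neither direction, an edge of the cycle.
\<close>

definition chordal :: "('a, 'b) pre_digraph \<Rightarrow> bool" where
  "chordal G \<longleftrightarrow>
     (\<forall>p. pre_digraph.cycle G p \<and> 4 \<le> length p \<longrightarrow>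
       (\<exists>u \<in> tail G ` set p. \<exists>v \<in> tail G ` set p.
          u \<rightarrow>\<^bsub>G\<^esub> v \<and> (\<forall>e\<in>set p. {tail G e, head G e} \<noteq> {u, v})))"

definition nbhd :: "('a, 'b) pre_digraph \<Rightarrow> 'a \<Rightarrow> 'a set" where
  "nbhd G v = {u. v \<rightarrow>\<^bsub>G\<^esub> u}"

definition simplicial :: "('a, 'b) pre_digraph \<Rightarrow> 'a \<Rightarrow> bool" where
  "simplicial G v \<longleftrightarrow> v \<in> verts G \<and> is_clique G (nbhd G v)"

definition is_peo :: "('a, 'b) pre_digraph \<Rightarrow> (nat \<Rightarrow> 'a) \<Rightarrow> bool" where
  "is_peo G \<sigma> \<longleftrightarrow>
     bij_betw \<sigma> {1..card (verts G)} (verts G) \<and>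
     (\<forall>i\<in>{1..card (verts G)}. simplicial (G \<restriction> (\<sigma> ` {i..card (verts G)})) (\<sigma> i))"

text \<open>The inverse \<open>\<sigma>\<^sup>-\<^sup>1\<close>, meaningful on the vertices of \<open>G\<close>.\<close>

definition pos :: "('a, 'b) pre_digraph \<Rightarrow> (nat \<Rightarrow> 'a) \<Rightarrow> 'a \<Rightarrow> nat" where
  "pos G \<sigma> = inv_into {1..card (verts G)} \<sigma>"

definition precedes :: "('a, 'b) pre_digraph \<Rightarrow> (nat \<Rightarrow> 'a) \<Rightarrow> 'a set \<Rightarrow> 'a set \<Rightarrow> bool" where
  "precedes G \<sigma> A B \<longleftrightarrow> (\<forall>a\<in>A. \<forall>b\<in>B. pos G \<sigma> a < pos G \<sigma> b)"

definition later_nbhd :: "('a, 'b) pre_digraph \<Rightarrow> (nat \<Rightarrow> 'a) \<Rightarrow> 'a \<Rightarrow> 'a set" where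
  "later_nbhd G \<sigma> v = {u \<in> nbhd G v. pos G \<sigma> v < pos G \<sigma> u}"

definition later_degree :: "('a, 'b) pre_digraph \<Rightarrow> (nat \<Rightarrow> 'a) \<Rightarrow> 'a \<Rightarrow> nat" where
  "later_degree G \<sigma> v = card (later_nbhd G \<sigma> v)"

definition s_set :: "('a, 'b) pre_digraph \<Rightarrow> (nat \<Rightarrow> 'a) \<Rightarrow> 'a set \<Rightarrow> 'a set" where
  "s_set G \<sigma> C = {x \<in> C. \<not> later_nbhd G \<sigma> x \<subseteq> C}"

text \<open>Here \<open>x\<close> is the labelling \<open>x\<^sub>1, \<dots>, x\<^sub>d\<close> of the maximum clique \<open>K\<close>, with \<open>d = card K\<close>.\<close>

definition admissible_peo ::
  "('a, 'b) pre_digraph \<Rightarrow> 'a set \<Rightarrow> (nat \<Rightarrow> 'a) \<Rightarrow> (nat \<Rightarrow> 'a) \<Rightarrow> bool" where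
  "admissible_peo G K x \<sigma> \<longleftrightarrow>
     is_peo G \<sigma> \<and>
     precedes G \<sigma> (verts G - K) K \<and>
     (\<forall>i\<in>{1..card K}. pos G \<sigma> (x i) = card (verts G) - i + 1) \<and>
     (\<forall>C. is_maximal_clique G C \<longrightarrow>
        precedes G \<sigma> (C - s_set G \<sigma> C) (s_set G \<sigma> C) \<and>
        (\<forall>i. card (s_set G \<sigma> C) < i \<and> i \<le> card C \<longrightarrow>
           (\<exists>!u. u \<in> C - s_set G \<sigma> C \<and> later_degree G \<sigma> u = i - 1)) \<and>
        (\<forall>C'. is_maximal_clique G C' \<and> C' \<noteq> C \<and> C \<inter> C' \<noteq> {} \<longrightarrow>
           precedes G \<sigma> (C - C') (C \<inter> C') \<or> precedes G \<sigma> (C' - C) (C \<inter> C')))"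


section \<open>The graph \<open>\<alpha>\<^sub>\<sigma>(G)\<close>\<close>

text \<open>
  If the later neighbours of \<open>u\<close> are listed as \<open>u\<^sub>1, u\<^sub>2, \<dots>\<close> in increasing order of position,
  then \<open>later_index G \<sigma> u v\<close> is the index \<open>i\<close> with \<open>v = u\<^sub>i\<close>.
\<close>

definition later_index :: "('a, 'b) pre_digraph \<Rightarrow> (nat \<Rightarrow> 'a) \<Rightarrow> 'a \<Rightarrow> 'a \<Rightarrow> nat" where
  "later_index G \<sigma> u v = card {w \<in> later_nbhd G \<sigma> u. pos G \<sigma> w \<le> pos G \<sigma> v}"

text \<open>
  The edge map on arcs, sending opposite arcs to opposite arcs. When \<open>K\<close> comes last in \<open>\<sigma>\<close>, the
  earlier end of an edge not inside \<open>K\<close> lies outside \<open>K\<close>.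
\<close>

definition alpha_arc ::
  "('a, 'b) pre_digraph \<Rightarrow> 'a set \<Rightarrow> (nat \<Rightarrow> 'a) \<Rightarrow> (nat \<Rightarrow> 'a) \<Rightarrow> 'a \<times> 'a \<Rightarrow> 'a \<times> 'a" where
  "alpha_arc G K x \<sigma> = (\<lambda>(u, v).
     if u \<in> K \<and> v \<in> K then (u, v)
     else if pos G \<sigma> u < pos G \<sigma> v then (u, x (later_index G \<sigma> u v))
     else (x (later_index G \<sigma> v u), v))"

definition alpha_graph ::
  "'a pair_pre_digraph \<Rightarrow> 'a set \<Rightarrow> (nat \<Rightarrow> 'a) \<Rightarrow> (nat \<Rightarrow> 'a) \<Rightarrow> 'a pair_pre_digraph" where
  "alpha_graph G K x \<sigma> = \<lparr> pverts = pverts G, parcs = alpha_arc (with_proj G) K x \<sigma> ` parcs G \<rparr>"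

end

theory Submission
  imports Defs
begin

text \<open>
  Let \<open>U\<^sub>i\<close> be the set of vertices with exactly \<open>i - 1\<close> later neighbours; both domination
  numbers are compared with \<open>|U\<^sub>i|\<close>. The graph \<open>T\<close> is the clique \<open>K\<close> together with an independent set in
  which \<open>u\<close> is joined to the first \<open>n\<^sub>\<sigma>(u)\<close> vertices of \<open>K\<close>, and so \<open>d\<^sub>i(T) = |U\<^sub>i|\<close>.
  In \<open>G\<close>, choose for \<open>u \<in> U\<^sub>i\<close> a maximal clique containing \<open>u\<close> and its later neighbours. By
  conditions (c) and (d) no \<open>i\<close>-clique lies in the chosen cliques of two different vertices, whence
  \<open>|U\<^sub>i| \<le> d\<^sub>i(G)\<close>. For \<open>i\<close> above the maximal intersection size, \<open>|s(C)| < i\<close> holds for all maximal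
  cliques \<open>C\<close>, and (c) injects the maximal cliques of order at least \<open>i\<close> into \<open>U\<^sub>i\<close>.
\<close>

section \<open>Cliques and domination numbers in finite graphs\<close>

lemma clique_subset: "is_clique H C \<Longrightarrow> B \<subseteq> C \<Longrightarrow> is_clique H B"
  by (auto simp: is_clique_def)

lemma finite_clique: "finite (verts H) \<Longrightarrow> is_clique H C \<Longrightarrow> finite C"
  by (auto simp: is_clique_def intro: finite_subset)

lemma finite_cliques:
  assumes "finite (verts H)"
  shows "finite {C. is_clique H C}"
  by (rule finite_subset[of _ "Pow (verts H)"]) (use assms in \<open>auto simp: is_clique_def\<close>)

lemma maximal_clique_is_clique: "is_maximal_clique H C \<Longrightarrow> is_clique H C"
  by (simp add: is_maximal_clique_def)

lemma clique_extends_to_maximal: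
  assumes "finite (verts H)" "is_clique H C"
  obtains M where "is_maximal_clique H M" "C \<subseteq> M"
proof -
  obtain M where "M \<in> {C. is_clique H C}" "C \<subseteq> M"
      "\<forall>B\<in>{C. is_clique H C}. M \<subseteq> B \<longrightarrow> M = B"
    using finite_has_maximal2[OF finite_cliques[OF assms(1)], of C] assms(2) by auto
  then show ?thesis using that[of M] unfolding is_maximal_clique_def by blast
qed

lemma clique_card_le:
  assumes "finite (verts H)" "is_clique H C"
  shows "card C \<le> clique_number H"
proof -
  have "finite {card C | C. is_clique H C}"
    using finite_cliques[OF assms(1)] by simp
  then show ?thesis
    unfolding clique_number_def using assms(2) by (intro Max_ge) auto
qed

lemma inter_maximal_cliques_card_le:
  assumes "finite (verts H)" "is_maximal_clique H C" "is_maximal_clique H C'" "C \<noteq> C'"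
  shows "card (C \<inter> C') \<le> kappa_tilde H"
proof -
  let ?S = "{card (C \<inter> C') | C C'. is_maximal_clique H C \<and> is_maximal_clique H C' \<and> C \<noteq> C'}"
  have "?S \<subseteq> (\<lambda>(C, C'). card (C \<inter> C')) ` ({C. is_clique H C} \<times> {C. is_clique H C})"
    by (auto simp: is_maximal_clique_def image_iff)
  moreover have "finite \<dots>" using finite_cliques[OF assms(1)] by simp
  ultimately have "finite ?S" by (rule finite_subset)
  then show ?thesis
    unfolding kappa_tilde_def using assms(2-) by (intro Max_ge) auto
qed

lemma dom_clique_number_le: "dominating_cliques H i D \<Longrightarrow> dom_clique_number H i \<le> card D"
  unfolding dom_clique_number_def by (rule Least_le) blast

text \<open>The family of all \<open>i\<close>-cliques is dominating, so the \<open>LEAST\<close> in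
  the definition ranges over a nonempty set.\<close>

lemma dom_clique_number_attained:
  obtains D where "dominating_cliques H i D" "card D = dom_clique_number H i"
proof -
  have "dominating_cliques H i {C. is_clique H C \<and> card C = i}"
    unfolding dominating_cliques_def
  proof (intro conjI ballI allI impI)
    fix C assume C: "is_maximal_clique H C \<and> i \<le> card C"
    then obtain B where B: "B \<subseteq> C" "card B = i" by (meson obtain_subset_with_card_n)
    then have "is_clique H B" using C clique_subset maximal_clique_is_clique by blast
    then show "\<exists>B\<in>{C. is_clique H C \<and> card C = i}. B \<subseteq> C" using B by blast
  qed auto
  then have "\<exists>k. \<exists>D. dominating_cliques H i D \<and> card D = k" by blast
  from LeastI_ex[OF this] show ?thesis
    using that unfolding dom_clique_number_def by blast
qed

text \<open>A dominating family has a member inside each \<open>M u\<close>, and \<open>inj\<close>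
  makes any choice of such members injective. Both lower bounds, for \<open>G\<close> and for
  \<open>T\<close>, come from this.\<close>

lemma card_le_dom_clique_number:
  assumes fin: "finite (verts H)"
    and M: "\<And>u. u \<in> U \<Longrightarrow> is_maximal_clique H (M u) \<and> i \<le> card (M u)"
    and inj: "\<And>u v B. \<lbrakk>u \<in> U; v \<in> U; B \<subseteq> M u; B \<subseteq> M v; card B = i\<rbrakk> \<Longrightarrow> u = v"
  shows "card U \<le> dom_clique_number H i"
proof -
  obtain D where D: "dominating_cliques H i D" "card D = dom_clique_number H i"
    by (rule dom_clique_number_attained)
  then have "\<forall>u\<in>U. \<exists>B. B \<in> D \<and> B \<subseteq> M u"
    using M unfolding dominating_cliques_def by blast
  then obtain f where f: "\<And>u. u \<in> U \<Longrightarrow> f u \<in> D \<and> f u \<subseteq> M u" by metis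
  have cardf: "card (f u) = i" if "u \<in> U" for u
    using f[OF that] D(1) unfolding dominating_cliques_def by blast
  have "inj_on f U"
    by (rule inj_onI) (metis f cardf inj)
  moreover have "finite D"
    by (rule finite_subset[OF _ finite_cliques[OF fin]])
       (use D(1) in \<open>auto simp: dominating_cliques_def\<close>)
  ultimately have "card U \<le> card D"
    using f by (intro card_inj_on_le[of f]) auto
  then show ?thesis using D(2) by simp
qed

text \<open>One \<open>i\<close>-subset chosen in each maximal clique of order at least
  \<open>i\<close> gives a dominating family.\<close>

lemma dom_clique_number_le_card_maximal_cliques:
  assumes "finite (verts H)"
  shows "dom_clique_number H i \<le> card {C. is_maximal_clique H C \<and> i \<le> card C}" (is "_ \<le> card ?M")
proof -
  have "\<forall>C\<in>?M. \<exists>B\<subseteq>C. card B = i" by (metis mem_Collect_eq obtain_subset_with_card_n)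
  then obtain f where f: "\<And>C. C \<in> ?M \<Longrightarrow> f C \<subseteq> C \<and> card (f C) = i" by metis
  have "dominating_cliques H i (f ` ?M)"
    unfolding dominating_cliques_def
  proof (intro conjI ballI allI impI)
    fix B assume "B \<in> f ` ?M"
    then obtain C where C: "C \<in> ?M" "B = f C" by (rule imageE)
    then show "is_clique H B" "card B = i"
      using f[OF C(1)] clique_subset[OF maximal_clique_is_clique] by auto
  next
    fix C assume "is_maximal_clique H C \<and> i \<le> card C"
    then have "C \<in> ?M" by simp
    then show "\<exists>B\<in>f ` ?M. B \<subseteq> C" using f by (intro bexI[of _ "f C"]) auto
  qed
  then have "dom_clique_number H i \<le> card (f ` ?M)" by (rule dom_clique_number_le)
  also have "\<dots> \<le> card ?M"
    by (rule card_image_le, rule finite_subset[OF _ finite_cliques[OF assms]])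
       (auto simp: is_maximal_clique_def)
  finally show ?thesis .
qed

section \<open>Ranks in a finite set\<close>

text \<open>The rank is strictly increasing in \<open>f\<close>, hence injective, and an injection
  from \<open>A\<close> into \<open>{1..card A}\<close> is onto.\<close>

lemma rank_image:
  fixes f :: "'a \<Rightarrow> 'b::linorder"
  assumes "finite A" "inj_on f A"
  shows "(\<lambda>v. card {w \<in> A. f w \<le> f v}) ` A = {1..card A}" (is "?r ` A = _")
proof (rule card_subset_eq)
  show "?r ` A \<subseteq> {1..card A}"
  proof (rule image_subsetI)
    fix v assume "v \<in> A"
    then have "card {w \<in> A. f w \<le> f v} \<noteq> 0" using assms(1) by auto
    moreover have "?r v \<le> card A" using assms(1) by (intro card_mono) auto
    ultimately show "?r v \<in> {1..card A}" by auto
  qed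
  have less: "?r u < ?r v" if "u \<in> A" "v \<in> A" "f u < f v" for u v
    using that assms(1) by (intro psubset_card_mono) force+
  have "inj_on ?r A"
  proof (rule inj_onI)
    fix u v assume "u \<in> A" "v \<in> A" "?r u = ?r v"
    then have "f u = f v" using less[of u v] less[of v u] by (cases "f u" "f v" rule: linorder_cases) simp_all
    then show "u = v" using \<open>u \<in> A\<close> \<open>v \<in> A\<close> assms(2) by (simp add: inj_on_eq_iff)
  qed
  then show "card (?r ` A) = card {1..card A}" by (simp add: card_image)
qed simp

section \<open>Positions and later neighbourhoods\<close>

locale admissible_graph = pair_graph G for G :: "'a pair_pre_digraph" +
  fixes K :: "'a set" and x \<sigma> :: "nat \<Rightarrow> 'a"
  assumes K_clique: "is_clique (with_proj G) K"
    and K_maximum: "clique_number (with_proj G) = card K"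
    and x_bij: "bij_betw x {1..card K} K"
    and admissible: "admissible_peo (with_proj G) K x \<sigma>"
begin

abbreviation p where "p \<equiv> pos (with_proj G) \<sigma>"
abbreviation N where "N \<equiv> later_nbhd (with_proj G) \<sigma>"
abbreviation deg where "deg \<equiv> later_degree (with_proj G) \<sigma>"
abbreviation s where "s \<equiv> s_set (with_proj G) \<sigma>"
abbreviation T where "T \<equiv> alpha_graph G K x \<sigma>"

text \<open>The set \<open>U\<^sub>i\<close>. Writing \<open>Suc (deg u) = i\<close> makes
  \<open>level 0\<close> empty; with truncated subtraction, \<open>deg u = i - 1\<close> would
  identify it with \<open>level 1\<close>.\<close>

definition level :: "nat \<Rightarrow> 'a set" where
  "level i = {u \<in> pverts G. Suc (deg u) = i}"

lemma finG: "finite (verts (with_proj G))"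
  by simp

lemma K_subset: "K \<subseteq> pverts G"
  using K_clique by (simp add: is_clique_def)

lemma peo: "is_peo (with_proj G) \<sigma>"
  using admissible by (simp add: admissible_peo_def)

lemma p_bij: "bij_betw p (pverts G) {1..card (pverts G)}"
  using peo bij_betw_inv_into[of \<sigma> "{1..card (pverts G)}" "pverts G"]
  by (simp add: is_peo_def pos_def)

lemma p_eq_iff: "u \<in> pverts G \<Longrightarrow> v \<in> pverts G \<Longrightarrow> p u = p v \<longleftrightarrow> u = v"
  using p_bij by (auto simp: bij_betw_def inj_on_eq_iff)

lemma \<sigma>_p: "u \<in> pverts G \<Longrightarrow> \<sigma> (p u) = u"
  using peo bij_betw_inv_into_right[of \<sigma> "{1..card (pverts G)}" "pverts G"]
  by (simp add: is_peo_def pos_def)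

lemma adj_sym: "(u \<rightarrow>\<^bsub>with_proj G\<^esub> v) \<Longrightarrow> (v \<rightarrow>\<^bsub>with_proj G\<^esub> u)"
  by (simp add: arcs_symmetric)

lemma N_iff: "v \<in> N u \<longleftrightarrow> u \<rightarrow>\<^bsub>with_proj G\<^esub> v \<and> p u < p v"
  by (simp add: later_nbhd_def nbhd_def)

lemma N_subset: "N u \<subseteq> pverts G"
  by (auto simp: N_iff dest: in_arcsD2)

lemma finite_N: "finite (N u)"
  by (rule finite_subset[OF N_subset]) simp

lemma card_insert_N: "card (insert u (N u)) = Suc (deg u)"
  using finite_N by (simp add: later_degree_def N_iff)

text \<open>\<open>u\<close> is simplicial in the subgraph induced by the vertices from position
  \<open>p u\<close> on, and every later neighbour of \<open>u\<close> is still a neighbour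
  there.\<close>

lemma insert_N_clique:
  assumes u: "u \<in> pverts G"
  shows "is_clique (with_proj G) (insert u (N u))"
proof -
  let ?n = "card (pverts G)"
  have pu: "p u \<in> {1..?n}" using p_bij u by (auto simp: bij_betw_def)
  let ?S = "\<sigma> ` {p u..?n}"
  have "simplicial (with_proj G \<restriction> ?S) (\<sigma> (p u))"
    using peo pu unfolding is_peo_def by auto
  then have cl: "is_clique (with_proj G \<restriction> ?S) (nbhd (with_proj G \<restriction> ?S) u)"
    using u by (simp add: simplicial_def \<sigma>_p)
  have inS: "v \<in> ?S" if "v \<in> pverts G" "p u \<le> p v" for v
  proof -
    have "p v \<in> {p u..?n}" using that p_bij by (auto simp: bij_betw_def)
    then show ?thesis using \<sigma>_p[OF that(1)] by force
  qed
  have "N u \<subseteq> nbhd (with_proj G \<restriction> ?S) u"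
  proof
    fix v assume v: "v \<in> N u"
    then have "v \<in> pverts G" using N_subset by blast
    then have "v \<in> ?S" "u \<in> ?S" using inS[of v] inS[of u] u v by (simp_all add: N_iff)
    then show "v \<in> nbhd (with_proj G \<restriction> ?S) u"
      using v by (force simp: N_iff nbhd_def arcs_ends_def arc_to_ends_def)
  qed
  moreover have "(v \<rightarrow>\<^bsub>with_proj G \<restriction> ?S\<^esub> w) \<Longrightarrow> (v \<rightarrow>\<^bsub>with_proj G\<^esub> w)" for v w
    by (auto simp: arcs_ends_def arc_to_ends_def)
  ultimately have "\<forall>v\<in>N u. \<forall>w\<in>N u. v \<noteq> w \<longrightarrow> v \<rightarrow>\<^bsub>with_proj G\<^esub> w"
    using cl unfolding is_clique_def by blast
  moreover have "\<forall>v\<in>N u. (u \<rightarrow>\<^bsub>with_proj G\<^esub> v) \<and> (v \<rightarrow>\<^bsub>with_proj G\<^esub> u)"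
    using N_iff adj_sym by blast
  ultimately show ?thesis
    using N_subset u unfolding is_clique_def by auto
qed

text \<open>The clique formed by \<open>u\<close> and its later neighbours is no larger than the
  maximum clique \<open>K\<close>. So \<open>K\<close> has enough labels for all later neighbours of
  \<open>u\<close>.\<close>

lemma Suc_deg_le: "u \<in> pverts G \<Longrightarrow> Suc (deg u) \<le> card K"
  using clique_card_le[OF finG insert_N_clique] by (simp add: card_insert_N K_maximum)

lemma level_le: "u \<in> level i \<Longrightarrow> i \<le> card K"
  using Suc_deg_le by (auto simp: level_def)

lemma clique_verts: "is_clique (with_proj G) C \<Longrightarrow> u \<in> C \<Longrightarrow> u \<in> pverts G"
  by (auto simp: is_clique_def)

lemma clique_later: "is_clique (with_proj G) C \<Longrightarrow> u \<in> C \<Longrightarrow> v \<in> C \<Longrightarrow> p u < p v \<Longrightarrow> v \<in> N u"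
  by (auto simp: is_clique_def N_iff)

section \<open>Maximal cliques under conditions (b), (c) and (d)\<close>

lemma not_s_iff: "u \<in> C - s C \<longleftrightarrow> insert u (N u) \<subseteq> C"
  by (auto simp: s_set_def)

text \<open>By (b), \<open>u\<close> precedes all of \<open>s C\<close>, so \<open>s C\<close>
  consists of later neighbours of \<open>u\<close>. The two bounds place \<open>Suc (deg u)\<close>
  in the range where (c) applies.\<close>

lemma card_s_less:
  assumes C: "is_maximal_clique (with_proj G) C" and u: "u \<in> C - s C"
  shows "card (s C) < Suc (deg u)" "Suc (deg u) \<le> card C"
proof -
  have "precedes (with_proj G) \<sigma> (C - s C) (s C)"
    using admissible C unfolding admissible_peo_def by blast
  then have "s C \<subseteq> N u"
    using u clique_later[OF maximal_clique_is_clique[OF C]]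
    by (auto simp: precedes_def s_set_def)
  then show "card (s C) < Suc (deg u)"
    using finite_N by (simp add: card_mono later_degree_def less_Suc_eq_le)
  show "Suc (deg u) \<le> card C"
    using u card_mono[of C "insert u (N u)"] finite_clique[OF finG maximal_clique_is_clique[OF C]]
    by (simp only: not_s_iff card_insert_N)
qed

text \<open>Condition (c) restated with \<open>Suc\<close>; since \<open>i\<close> exceeds
  \<open>card (s C)\<close>, it is positive and \<open>i - 1\<close> does not truncate.\<close>

lemma ex1_level:
  assumes "is_maximal_clique (with_proj G) C" "card (s C) < i" "i \<le> card C"
  shows "\<exists>!u. u \<in> C - s C \<and> Suc (deg u) = i"
proof -
  have "\<exists>!u. u \<in> C - s C \<and> deg u = i - 1"
    using admissible assms unfolding admissible_peo_def by blast
  moreover have "Suc k = i \<longleftrightarrow> k = i - 1" for k using assms(2) by auto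
  ultimately show ?thesis by simp
qed

lemma level_unique:
  assumes C: "is_maximal_clique (with_proj G) C"
    and "u \<in> C - s C" "v \<in> C - s C" "deg u = deg v"
  shows "u = v"
  using ex1_level[OF C card_s_less[OF C assms(2)]] assms by auto

text \<open>
  By counting, \<open>u\<close> cannot precede all of \<open>C \<inter> C'\<close>, so it lies in \<open>C \<inter> C'\<close>; being in the final part
  \<open>C \<inter> C'\<close> of \<open>C\<close>, it has all its later neighbours there as well.
\<close>

lemma shared_clique_precedes:
  assumes C: "is_maximal_clique (with_proj G) C" and C': "is_maximal_clique (with_proj G) C'"
    and u: "u \<in> C - s C" and v: "v \<in> C' - s C'" and deg: "deg u = deg v"
    and B: "B \<subseteq> C" "B \<subseteq> C'" "card B = Suc (deg u)"
    and prec: "precedes (with_proj G) \<sigma> (C - C') (C \<inter> C')"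
  shows "u = v"
proof -
  have NC: "N u \<subseteq> C" using u unfolding not_s_iff by blast
  have "u \<in> C'"
  proof (rule ccontr)
    assume "u \<notin> C'"
    then have "p u < p w" if "w \<in> B" for w
      using B u prec that unfolding precedes_def by blast
    then have "B \<subseteq> N u"
      using B u clique_later[OF maximal_clique_is_clique[OF C]] by blast
    then have "card B \<le> deg u"
      using finite_N by (simp add: card_mono later_degree_def)
    then show False using B(3) by simp
  qed
  moreover have "N u \<subseteq> C'"
  proof (rule ccontr)
    assume "\<not> N u \<subseteq> C'"
    then obtain w where "w \<in> N u" "w \<in> C - C'" using NC by blast
    then have "p w < p u" using prec u \<open>u \<in> C'\<close> by (auto simp: precedes_def)
    then show False using \<open>w \<in> N u\<close> by (simp add: N_iff)
  qed
  ultimately have "u \<in> C' - s C'" using u unfolding not_s_iff by blast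
  then show ?thesis using level_unique[OF C'] v deg by blast
qed

text \<open>The nonempty \<open>B\<close> makes \<open>C\<close> and \<open>C'\<close> meet, so (d)
  lets one of the two differences precede the intersection. The two cases are exchanged by swapping
  the cliques.\<close>

lemma shared_clique:
  assumes C: "is_maximal_clique (with_proj G) C" and C': "is_maximal_clique (with_proj G) C'"
    and u: "u \<in> C - s C" and v: "v \<in> C' - s C'" and deg: "deg u = deg v"
    and B: "B \<subseteq> C" "B \<subseteq> C'" "card B = Suc (deg u)"
  shows "u = v"
proof (cases "C = C'")
  case True
  then show ?thesis using level_unique[OF C] u v deg by blast
next
  case False
  have "B \<noteq> {}" using B(3) by auto
  then have "C \<inter> C' \<noteq> {}" using B by blast
  then have "precedes (with_proj G) \<sigma> (C - C') (C \<inter> C')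
      \<or> precedes (with_proj G) \<sigma> (C' - C) (C' \<inter> C)"
    using admissible C C' False unfolding admissible_peo_def by (metis Int_commute)
  then show ?thesis
  proof
    assume "precedes (with_proj G) \<sigma> (C - C') (C \<inter> C')"
    then show ?thesis by (rule shared_clique_precedes[OF assms])
  next
    assume prec: "precedes (with_proj G) \<sigma> (C' - C) (C' \<inter> C)"
    have "card B = Suc (deg v)" using B(3) deg by simp
    from shared_clique_precedes[OF C' C v u deg[symmetric] B(2,1) this prec]
    show ?thesis by (rule sym)
  qed
qed

section \<open>Bounds on the domination numbers of \<open>G\<close>\<close>

lemma card_level_le_dom: "card (level i) \<le> dom_clique_number (with_proj G) i"
proof -
  have "\<forall>u\<in>level i. \<exists>C. is_maximal_clique (with_proj G) C \<and> insert u (N u) \<subseteq> C"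
    using clique_extends_to_maximal[OF finG insert_N_clique] unfolding level_def by blast
  then obtain M where M: "\<And>u. u \<in> level i \<Longrightarrow>
      is_maximal_clique (with_proj G) (M u) \<and> insert u (N u) \<subseteq> M u" by metis
  \<comment> \<open>Because \<open>M u\<close> contains all later neighbours of \<open>u\<close>,
    the vertex avoids \<open>s (M u)\<close>, as the uniqueness in (c) requires.\<close>
  have Ms: "u \<in> M u - s (M u)" if "u \<in> level i" for u
    using M[OF that] unfolding not_s_iff by blast
  show ?thesis
  proof (rule card_le_dom_clique_number[OF finG])
    show "is_maximal_clique (with_proj G) (M u) \<and> i \<le> card (M u)" if "u \<in> level i" for u
      using M[OF that] card_s_less(2)[OF _ Ms[OF that]] that by (auto simp: level_def)
    show "u = v" if uv: "u \<in> level i" "v \<in> level i" and B: "B \<subseteq> M u" "B \<subseteq> M v" "card B = i" for u v B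
    proof -
      have "deg u = deg v" "card B = Suc (deg u)" using uv B(3) by (auto simp: level_def)
      moreover have "is_maximal_clique (with_proj G) (M u)" "is_maximal_clique (with_proj G) (M v)"
        using M uv by blast+
      ultimately show ?thesis using shared_clique[OF _ _ Ms[OF uv(1)] Ms[OF uv(2)] _ B(1,2)] by blast
    qed
  qed
qed

text \<open>Let \<open>z\<close> be the earliest vertex of \<open>s C\<close>. The other vertices of
  \<open>s C\<close> are later neighbours of \<open>z\<close>, so a maximal clique \<open>C'\<close>
  containing \<open>z\<close> and \<open>N z\<close> contains \<open>s C\<close>. It differs from
  \<open>C\<close> because \<open>z\<close> has a later neighbour outside \<open>C\<close>.\<close>

lemma card_s_le_kappa_tilde:
  assumes C: "is_maximal_clique (with_proj G) C" and "s C \<noteq> {}"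
  shows "card (s C) \<le> kappa_tilde (with_proj G)"
proof -
  note Ccl = maximal_clique_is_clique[OF C]
  have sC: "s C \<subseteq> C" by (auto simp: s_set_def)
  then have fin: "finite (s C)" using finite_clique[OF finG Ccl] finite_subset by blast
  define z where "z = arg_min_on p (s C)"
  have z: "z \<in> s C" "\<And>w. w \<in> s C \<Longrightarrow> p z \<le> p w"
    unfolding z_def using arg_min_if_finite(1)[OF fin assms(2)] arg_min_least[OF fin assms(2)] by blast+
  have zV: "z \<in> pverts G" using z sC clique_verts[OF Ccl] by blast
  then obtain C' where C': "is_maximal_clique (with_proj G) C'" "insert z (N z) \<subseteq> C'"
    using clique_extends_to_maximal[OF finG insert_N_clique] by blast
  have "C \<noteq> C'" using z(1) C'(2) by (auto simp: s_set_def)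
  have "s C \<subseteq> insert z (N z)"
  proof
    fix w assume w: "w \<in> s C"
    then have "w \<in> pverts G" using sC clique_verts[OF Ccl] by blast
    then have "p z < p w \<or> w = z" using z(2)[OF w] p_eq_iff[OF zV, of w] by auto
    then show "w \<in> insert z (N z)"
      using clique_later[OF Ccl, of z w] w z(1) sC by blast
  qed
  then have "s C \<subseteq> C \<inter> C'" using sC C'(2) by blast
  then have "card (s C) \<le> card (C \<inter> C')"
    using finite_clique[OF finG Ccl] by (intro card_mono) auto
  then show ?thesis
    using inter_maximal_cliques_card_le[OF finG C C'(1) \<open>C \<noteq> C'\<close>] by simp
qed

text \<open>Two maximal cliques with the same representative \<open>u\<close> would share
  \<open>u\<close> and all its later neighbours, which are \<open>i\<close> vertices and hence too
  many for an intersection.\<close>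

lemma dom_le_card_level:
  assumes i: "kappa_tilde (with_proj G) < i"
  shows "dom_clique_number (with_proj G) i \<le> card (level i)"
proof -
  let ?M = "{C. is_maximal_clique (with_proj G) C \<and> i \<le> card C}"
  have "\<exists>u. u \<in> C - s C \<and> Suc (deg u) = i" if "C \<in> ?M" for C
  proof -
    \<comment> \<open>If \<open>s C\<close> is empty, the claim is that \<open>i\<close> is
      positive, which follows from \<open>kappa_tilde (with_proj G) < i\<close>.\<close>
    have "card (s C) < i" using card_s_le_kappa_tilde[of C] that i by (cases "s C = {}") auto
    then show ?thesis using ex1_level[of C i] that by auto
  qed
  then obtain f where f: "\<And>C. C \<in> ?M \<Longrightarrow> f C \<in> C - s C \<and> Suc (deg (f C)) = i" by metis
  have "inj_on f ?M"
  proof (rule inj_onI, rule ccontr)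
    fix C C' assume C: "C \<in> ?M" "C' \<in> ?M" "f C = f C'" "C \<noteq> C'"
    have "insert (f C) (N (f C)) \<subseteq> C \<inter> C'"
      using f[OF C(1)] f[OF C(2)] C(3) unfolding not_s_iff by auto
    moreover have "finite (C \<inter> C')"
      using C finite_clique[OF finG maximal_clique_is_clique] by auto
    ultimately have "i \<le> card (C \<inter> C')"
      using f[OF C(1)] card_insert_N[of "f C"] card_mono by metis
    then show False
      using inter_maximal_cliques_card_le[OF finG, of C C'] C i by auto
  qed
  moreover have "f ` ?M \<subseteq> level i"
    using f clique_verts[OF maximal_clique_is_clique] unfolding level_def by blast
  moreover have "finite (level i)" using finG by (simp add: level_def)
  ultimately have "card ?M \<le> card (level i)" by (intro card_inj_on_le[of f])
  then show ?thesis
    using dom_clique_number_le_card_maximal_cliques[OF finG, of i] by simp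
qed

section \<open>The clique \<open>K\<close> at the end of the ordering\<close>

lemma K_last: "u \<in> pverts G \<Longrightarrow> u \<notin> K \<Longrightarrow> v \<in> K \<Longrightarrow> p u < p v"
  using admissible unfolding admissible_peo_def precedes_def by auto

lemma p_x: "i \<in> {1..card K} \<Longrightarrow> p (x i) = card (pverts G) - i + 1"
  using admissible unfolding admissible_peo_def by auto

lemma x_in_K: "i \<in> {1..card K} \<Longrightarrow> x i \<in> K"
  using x_bij by (auto simp: bij_betw_def)

lemma K_eq: "K = x ` {1..card K}"
  using x_bij by (auto simp: bij_betw_def)

lemma x_inj: "inj_on x {1..card K}"
  using x_bij by (auto simp: bij_betw_def)

text \<open>The labels run backwards along the ordering and nothing outside \<open>K\<close> comes
  after a vertex of \<open>K\<close>, so the later neighbours of \<open>x i\<close> are the vertices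
  with smaller labels.\<close>

lemma deg_x:
  assumes i: "i \<in> {1..card K}"
  shows "Suc (deg (x i)) = i"
proof -
  \<comment> \<open>Keeps \<open>card (pverts G) - i + 1\<close> from truncating, so that positions
    strictly decrease with the label.\<close>
  have le: "card K \<le> card (pverts G)" using K_subset finG by (intro card_mono) auto
  have xK: "x i \<in> K" using x_in_K[OF i] .
  have p_less: "p (x i) < p (x j) \<longleftrightarrow> j < i" if "j \<in> {1..card K}" for j
    using p_x[OF i] p_x[OF that] i that le by auto
  have "N (x i) = x ` {1..<i}"
  proof
    show "N (x i) \<subseteq> x ` {1..<i}"
    proof
      fix v assume v: "v \<in> N (x i)"
      then have "v \<in> K" using K_last[of v "x i"] xK N_subset by (force simp: N_iff)
      then obtain j where j: "j \<in> {1..card K}" "v = x j" using K_eq by blast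
      then show "v \<in> x ` {1..<i}" using p_less v by (auto simp: N_iff)
    qed
    show "x ` {1..<i} \<subseteq> N (x i)"
    proof
      fix v assume "v \<in> x ` {1..<i}"
      then obtain j where j: "j \<in> {1..card K}" "v = x j" "j < i" using i by auto
      then show "v \<in> N (x i)"
        using clique_later[OF K_clique xK x_in_K[OF j(1)]] p_less by simp
    qed
  qed
  moreover have "inj_on x {1..<i}" by (rule inj_on_subset[OF x_inj]) (use i in auto)
  ultimately have "deg (x i) = i - 1" by (simp add: later_degree_def card_image)
  then show ?thesis using i by simp
qed

lemma K_level: "u \<in> K \<Longrightarrow> u \<in> level i \<Longrightarrow> u = x i"
  by (metis (mono_tags, lifting) K_eq deg_x imageE level_def mem_Collect_eq)

lemma x_level: "i \<in> {1..card K} \<Longrightarrow> x i \<in> level i"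
  using deg_x x_in_K K_subset by (auto simp: level_def)

section \<open>Adjacency in \<open>T\<close>\<close>

lemma later_index_image: "later_index (with_proj G) \<sigma> u ` N u = {1..deg u}"
proof -
  have "inj_on p (N u)" using p_eq_iff N_subset by (meson inj_onI subsetD)
  from rank_image[OF finite_N this] show ?thesis
    unfolding later_index_def later_degree_def .
qed

text \<open>The cases are an edge inside \<open>K\<close>, an edge with earlier end
  \<open>a\<close>, and an edge with earlier end \<open>b\<close>. An earlier end \<open>u\<close>
  outside \<open>K\<close> is joined to exactly the first \<open>deg u\<close> labelled vertices
  because \<open>later_index\<close> maps \<open>N u\<close> onto \<open>{1..deg u}\<close>.\<close>

lemma T_adj_iff:
  "(a \<rightarrow>\<^bsub>with_proj T\<^esub> b) \<longleftrightarrow>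
     a \<in> K \<and> b \<in> K \<and> a \<noteq> b \<or>
     a \<in> pverts G - K \<and> b \<in> x ` {1..deg a} \<or>
     b \<in> pverts G - K \<and> a \<in> x ` {1..deg b}" (is "?L \<longleftrightarrow> ?R")
proof -
  have L: "?L \<longleftrightarrow> (\<exists>(u, v)\<in>parcs G. alpha_arc (with_proj G) K x \<sigma> (u, v) = (a, b))"
    by (force simp: alpha_graph_def)
  show ?thesis
  proof
    assume ?L
    then obtain u v where uv: "(u, v) \<in> parcs G" "alpha_arc (with_proj G) K x \<sigma> (u, v) = (a, b)"
      using L by blast
    have V: "u \<in> pverts G" "v \<in> pverts G" "u \<noteq> v" and adj: "u \<rightarrow>\<^bsub>with_proj G\<^esub> v" "v \<rightarrow>\<^bsub>with_proj G\<^esub> u"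
      using uv(1) in_arcsD1 in_arcsD2 no_loops' by (auto intro: arcs_symmetric)
    consider "u \<in> K" "v \<in> K" | "\<not> (u \<in> K \<and> v \<in> K)" "p u < p v" | "\<not> (u \<in> K \<and> v \<in> K)" "p v < p u"
      using V p_eq_iff by force
    then show ?R
    proof cases
      case 1
      then show ?thesis using uv(2) V by (auto simp: alpha_arc_def)
    next
      case 2
      \<comment> \<open>If \<open>u\<close> were in \<open>K\<close>, then \<open>v\<close> would
        lie outside \<open>K\<close> and so come before \<open>u\<close>.\<close>
      then have "u \<notin> K" using K_last[of v u] V by auto
      moreover have "later_index (with_proj G) \<sigma> u v \<in> {1..deg u}"
        using 2 adj later_index_image[of u] by (auto simp: N_iff)
      ultimately show ?thesis using uv(2) 2 V by (auto simp: alpha_arc_def)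
    next
      case 3
      then have "v \<notin> K" using K_last[of u v] V by auto
      moreover have "later_index (with_proj G) \<sigma> v u \<in> {1..deg v}"
        using 3 adj later_index_image[of v] by (auto simp: N_iff)
      ultimately show ?thesis using uv(2) 3 V by (auto simp: alpha_arc_def)
    qed
  next
    \<comment> \<open>Surjectivity of the index supplies an edge of \<open>G\<close> that is mapped
      to the given edge of \<open>T\<close>.\<close>
    have out: "\<exists>v. v \<in> N u \<and> w = x (later_index (with_proj G) \<sigma> u v)" if "w \<in> x ` {1..deg u}" for u w
      using that later_index_image[of u, symmetric] by auto
    assume ?R
    then show ?L
    proof (elim disjE)
      assume "a \<in> K \<and> b \<in> K \<and> a \<noteq> b"
      moreover from this have "(a, b) \<in> parcs G" using K_clique by (auto simp: is_clique_def)
      ultimately show ?L unfolding L by (intro bexI[of _ "(a, b)"]) (auto simp: alpha_arc_def)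
    next
      assume a: "a \<in> pverts G - K \<and> b \<in> x ` {1..deg a}"
      then obtain v where v: "v \<in> N a" "b = x (later_index (with_proj G) \<sigma> a v)" using out by blast
      then show ?L unfolding L using a
        by (intro bexI[of _ "(a, v)"]) (auto simp: alpha_arc_def N_iff)
    next
      assume b: "b \<in> pverts G - K \<and> a \<in> x ` {1..deg b}"
      then obtain v where v: "v \<in> N b" "a = x (later_index (with_proj G) \<sigma> b v)" using out by blast
      then have "(v, b) \<in> parcs G" by (auto simp: N_iff dest: arcs_symmetric)
      then show ?L unfolding L using b v
        by (intro bexI[of _ "(v, b)"]) (auto simp: alpha_arc_def N_iff)
    qed
  qed
qed

section \<open>Cliques of \<open>T\<close>\<close>

lemma verts_T: "verts (with_proj T) = pverts G"
  by (simp add: alpha_graph_def)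

lemma finT: "finite (verts (with_proj T))"
  unfolding verts_T using finG by simp

lemma clique_T_verts: "is_clique (with_proj T) C \<Longrightarrow> u \<in> C \<Longrightarrow> u \<in> pverts G"
  unfolding is_clique_def verts_T by blast

lemma x_image_subset: "u \<in> pverts G \<Longrightarrow> x ` {1..deg u} \<subseteq> K"
  using Suc_deg_le[of u] x_in_K by force

lemma card_insert_x:
  assumes "u \<in> pverts G" "u \<notin> x ` {1..deg u}"
  shows "card (insert u (x ` {1..deg u})) = Suc (deg u)"
proof -
  have "inj_on x {1..deg u}"
    by (rule inj_on_subset[OF x_inj]) (use Suc_deg_le[OF assms(1)] in auto)
  then show ?thesis using assms(2) by (simp add: card_image)
qed

lemma K_clique_T: "is_clique (with_proj T) K"
  using K_subset unfolding is_clique_def verts_T T_adj_iff by blast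

lemma outer_clique_T:
  assumes u: "u \<in> pverts G" "u \<notin> K"
  shows "is_clique (with_proj T) (insert u (x ` {1..deg u}))"
  using u x_image_subset[OF u(1)] K_subset
  unfolding is_clique_def verts_T T_adj_iff by blast

text \<open>The vertices outside \<open>K\<close> are independent in \<open>T\<close>, so all
  neighbours of \<open>u\<close> are among the first \<open>deg u\<close> labelled vertices.\<close>

lemma clique_T_subset_outer:
  assumes C: "is_clique (with_proj T) C" and u: "u \<in> C" "u \<notin> K"
  shows "C \<subseteq> insert u (x ` {1..deg u})"
proof
  fix v assume v: "v \<in> C"
  have V: "v \<in> pverts G" "u \<in> pverts G" using C v u clique_T_verts by blast+
  show "v \<in> insert u (x ` {1..deg u})"
  proof (cases "v = u")
    case False
    have "\<forall>a\<in>C. \<forall>b\<in>C. a \<noteq> b \<longrightarrow> a \<rightarrow>\<^bsub>with_proj T\<^esub> b"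
      using C unfolding is_clique_def by (rule conjunct2)
    from this[rule_format, OF u(1) v] have "u \<rightarrow>\<^bsub>with_proj T\<^esub> v" using False by auto
    moreover have "u \<notin> x ` {1..deg v}" using u(2) x_image_subset[OF V(1)] by (meson subsetD)
    ultimately show ?thesis using u(2) unfolding T_adj_iff by simp
  qed simp
qed

lemma outer_maximal_clique_T:
  assumes u: "u \<in> pverts G" "u \<notin> K"
  shows "is_maximal_clique (with_proj T) (insert u (x ` {1..deg u}))"
  using outer_clique_T[OF u] clique_T_subset_outer[OF _ _ u(2)]
  unfolding is_maximal_clique_def by blast

text \<open>A vertex \<open>u\<close> extending \<open>K\<close> would be adjacent to all of
  \<open>K\<close>, but it has only \<open>deg u < card K\<close> neighbours in
  \<open>T\<close>.\<close>

lemma K_maximal_clique_T: "is_maximal_clique (with_proj T) K"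
  unfolding is_maximal_clique_def
proof (intro conjI allI impI)
  show "is_clique (with_proj T) K" by (rule K_clique_T)
  fix C assume C: "is_clique (with_proj T) C \<and> K \<subseteq> C"
  show "C = K"
  proof (rule ccontr)
    assume "C \<noteq> K"
    then obtain u where u: "u \<in> C" "u \<notin> K" using C by blast
    then have uV: "u \<in> pverts G" using C clique_T_verts by blast
    have "K \<subseteq> x ` {1..deg u}" using clique_T_subset_outer[of C u] C u by blast
    then have "card K \<le> card {1..deg u}" by (rule surj_card_le[rotated]) simp
    then show False using Suc_deg_le[OF uV] by simp
  qed
qed

section \<open>The domination numbers of \<open>T\<close>\<close>

text \<open>For \<open>u\<close> in \<open>level i\<close> outside \<open>K\<close>, the maximal
  clique \<open>?A u\<close> has exactly \<open>i\<close> vertices, so its only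
  \<open>i\<close>-subset contains \<open>u\<close> and lies neither in \<open>K\<close> nor in
  another such clique. At most one vertex of \<open>level i\<close> lies in
  \<open>K\<close>.\<close>

lemma card_level_le_dom_T: "card (level i) \<le> dom_clique_number (with_proj T) i"
proof -
  let ?A = "\<lambda>u. insert u (x ` {1..deg u})"
  have cA: "card (?A u) = i \<and> finite (?A u)" if "u \<in> level i" "u \<notin> K" for u
  proof -
    have "u \<in> pverts G" "Suc (deg u) = i" using that(1) by (simp_all add: level_def)
    moreover from this have "u \<notin> x ` {1..deg u}" using x_image_subset[of u] that(2) by blast
    ultimately show ?thesis using card_insert_x by simp
  qed
  define M where "M u = (if u \<in> K then K else ?A u)" for u
  have full: "B = ?A u" if "u \<in> level i" "u \<notin> K" "B \<subseteq> M u" "card B = i" for u B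
    using that cA[OF that(1,2)] by (simp add: M_def card_subset_eq)
  have inside: "u \<in> K \<Longrightarrow> B \<subseteq> M u \<Longrightarrow> B \<subseteq> K" for u B by (simp add: M_def)
  show ?thesis
  proof (rule card_le_dom_clique_number[OF finT])
    show "is_maximal_clique (with_proj T) (M u) \<and> i \<le> card (M u)" if u: "u \<in> level i" for u
      using u level_le[OF u] cA[OF u] K_maximal_clique_T outer_maximal_clique_T[of u]
      by (auto simp: M_def level_def)
    show "u = v" if uv: "u \<in> level i" "v \<in> level i" "B \<subseteq> M u" "B \<subseteq> M v" "card B = i" for u v B
    proof -
      have outer: "w \<in> B" "B \<subseteq> insert w K" if "w \<in> level i" "w \<notin> K" "B \<subseteq> M w" for w
        using full[OF that uv(5)] x_image_subset[of w] that(1) by (auto simp: level_def)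
      show ?thesis
      proof (cases "u \<in> K")
        case True
        then have "B \<subseteq> K" using inside uv(3) by blast
        then have "v \<in> K" using outer(1)[OF uv(2) _ uv(4)] by blast
        then show ?thesis using K_level True uv(1,2) by blast
      next
        case False
        then have u: "u \<in> B" by (rule outer(1)[OF uv(1) _ uv(3)])
        then have "v \<notin> K" using inside[OF _ uv(4)] False by blast
        then have "B \<subseteq> insert v K" by (rule outer(2)[OF uv(2) _ uv(4)])
        then show ?thesis using u False by blast
      qed
    qed
  qed
qed

text \<open>The cliques \<open>?A u\<close> with \<open>u\<close> in \<open>level i\<close>
  dominate. The one for \<open>x i\<close> consists of the first \<open>i\<close> labelled vertices
  and serves \<open>K\<close> and every outer maximal clique of order above \<open>i\<close>; an
  outer maximal clique of order \<open>i\<close> is itself in the family. For \<open>i = 0\<close>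
  the level is empty, but the empty clique would have to be chosen.\<close>

lemma dom_T_le_card_level:
  assumes i: "1 \<le> i"
  shows "dom_clique_number (with_proj T) i \<le> card (level i)"
proof -
  let ?A = "\<lambda>u. insert u (x ` {1..deg u})"
  have Ax: "?A (x j) = x ` {1..j}" if "j \<in> {1..card K}" for j
  proof -
    have "{1..j} = insert j {1..deg (x j)}" using deg_x[OF that] by auto
    then show ?thesis by simp
  qed
  have "dominating_cliques (with_proj T) i (?A ` level i)"
    unfolding dominating_cliques_def
  proof (intro conjI ballI allI impI)
    fix B assume "B \<in> ?A ` level i"
    then obtain u where u: "u \<in> level i" "B = ?A u" by blast
    then have uV: "u \<in> pverts G" by (simp add: level_def)
    show "is_clique (with_proj T) B"
    proof (cases "u \<in> K")
      case True
      then have "B \<subseteq> K" using u x_image_subset[OF uV] by blast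
      then show ?thesis by (rule clique_subset[OF K_clique_T])
    next
      case False
      then show ?thesis using outer_clique_T[OF uV] u by simp
    qed
    \<comment> \<open>This covers \<open>u\<close> in \<open>K\<close> too: \<open>x j\<close> has
      only \<open>j - 1\<close> later neighbours, so \<open>u = x j\<close> contradicts
      \<open>j \<le> deg u\<close>.\<close>
    have "u \<notin> x ` {1..deg u}"
    proof
      assume "u \<in> x ` {1..deg u}"
      then obtain j where "j \<in> {1..deg u}" "u = x j" by blast
      moreover from this have "j \<in> {1..card K}" using Suc_deg_le[OF uV] by auto
      ultimately show False using deg_x[of j] by simp
    qed
    then show "card B = i" using card_insert_x[OF uV] u by (simp add: level_def)
  next
    fix C assume C: "is_maximal_clique (with_proj T) C \<and> i \<le> card C"
    then have Ccl: "is_clique (with_proj T) C" by (simp add: maximal_clique_is_clique)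
    show "\<exists>B\<in>?A ` level i. B \<subseteq> C"
    proof (cases "C \<subseteq> K")
      case True
      then have "C = K" using C K_clique_T unfolding is_maximal_clique_def by blast
      then have "i \<in> {1..card K}" using i C by simp
      then have "?A (x i) = x ` {1..i}" "x i \<in> level i" by (rule Ax, rule x_level)
      moreover have "x ` {1..i} \<subseteq> C" using \<open>C = K\<close> \<open>i \<in> {1..card K}\<close> x_in_K by auto
      ultimately show ?thesis by (intro bexI[of _ "?A (x i)"] imageI) (simp_all only:)
    next
      case False
      then obtain u where u: "u \<in> C" "u \<notin> K" by blast
      then have uV: "u \<in> pverts G" using Ccl clique_T_verts by blast
      have C_eq: "C = ?A u"
        using C clique_T_subset_outer[OF Ccl u] outer_clique_T[OF uV u(2)]
        unfolding is_maximal_clique_def by blast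
      have "u \<notin> x ` {1..deg u}" using x_image_subset[OF uV] u(2) by blast
      then have "i \<le> Suc (deg u)" using C C_eq card_insert_x[OF uV] by simp
      then consider "i = Suc (deg u)" | "i \<le> deg u" by linarith
      then show ?thesis
      proof cases
        case 1
        then have "u \<in> level i" using uV by (simp add: level_def)
        then show ?thesis using C_eq by blast
      next
        case 2
        then have "i \<in> {1..card K}" using i Suc_deg_le[OF uV] by simp
        then have "?A (x i) = x ` {1..i}" "x i \<in> level i" by (rule Ax, rule x_level)
        moreover have "x ` {1..i} \<subseteq> C" unfolding C_eq using 2 by auto
        ultimately show ?thesis by (intro bexI[of _ "?A (x i)"] imageI) (simp_all only:)
      qed
    qed
  qed
  then have "dom_clique_number (with_proj T) i \<le> card (?A ` level i)"
    by (rule dom_clique_number_le)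
  also have "\<dots> \<le> card (level i)"
    using finG by (intro card_image_le) (simp add: level_def)
  finally show ?thesis .
qed

end

theorem theorem5p8:
  fixes G T :: "'a pair_pre_digraph" and K :: "'a set"
    and x \<sigma> :: "nat \<Rightarrow> 'a" and n d :: nat
  assumes "pair_graph G" and "chordal (with_proj G)"
    and "card (pverts G) = n" and "\<not> complete_digraph n (with_proj G)"
    and "clique_number (with_proj G) = d"
    and "is_clique (with_proj G) K" and "card K = d" and "bij_betw x {1..d} K"
    and "admissible_peo (with_proj G) K x \<sigma>"
    and "T = alpha_graph G K x \<sigma>"
  shows "(\<forall>i\<in>{1..d}. dom_clique_number (with_proj T) i \<le> dom_clique_number (with_proj G) i) \<and>
         (\<forall>i>kappa_tilde (with_proj G).
            dom_clique_number (with_proj T) i = dom_clique_number (with_proj G) i)"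
proof -
  interpret admissible_graph G K x \<sigma>
    using assms by (simp add: admissible_graph_def admissible_graph_axioms_def)
  show ?thesis
    unfolding assms(10)
  proof (intro conjI ballI allI impI)
    fix i assume "i \<in> {1..d}"
    then show "dom_clique_number (with_proj (alpha_graph G K x \<sigma>)) i
        \<le> dom_clique_number (with_proj G) i"
      using dom_T_le_card_level[of i] card_level_le_dom[of i] by simp
  next
    fix i assume "kappa_tilde (with_proj G) < i"
    then show "dom_clique_number (with_proj (alpha_graph G K x \<sigma>)) i
        = dom_clique_number (with_proj G) i"
      \<comment> \<open>Here \<open>i\<close> is positive because it exceeds a natural number. For
        \<open>i\<close> above \<open>d\<close> the level is empty and both numbers are 0.\<close>
      using dom_T_le_card_level[of i] card_level_le_dom[of i]
        card_level_le_dom_T[of i] dom_le_card_level[of i] by simp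
  qed
qed

end
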